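(* Let $p\ge0$, $q\ge0$, $m\ge0$ be integers and let $f,g,h$ be entire functions represented by vector valued Dirichlet series such that $f$ has relative index-pair $(m,q)$ and $g$ has relative index-pair $(m,p)$ with respect to $h$. Then $$\max\left\{\left[\frac{\overline{\tau}_h^{(m,q)}(f)}{\overline{\tau}_h^{(m,p)}(g)}\right]^{\frac{1}{\lambda_h^{(m,p)}(g)}},\left[\frac{\tau_h^{(m,q)}(f)}{\tau_h^{(m,p)}(g)}\right]^{\frac{1}{\lambda_h^{(m,p)}(g)}}\right\}\le\overline{\tau}_g^{(p,q)}(f)\le\left[\frac{\overline{\tau}_h^{(m,q)}(f)}{\overline{\Delta}_h^{(m,p)}(g)}\right]^{\frac{1}{\rho_h^{(m,p)}(g)}}.$$
   Context: VVDS: an entire function represented by a vector valued Dirichlet series is a function $f(s)=\sum_{n\ge1}a_ne^{s\lambda_n}$, $s=\sigma+it$, not identically zero, with $a_n$ in a complex Banach space $(E,\|\cdot\|)$, $0<\lambda_n<\lambda_{n+1}$, $\lambda_n\to+\infty$, $\limsup_{n}\frac{\log n}{\lambda_n}<+\infty$ and $\limsup_{n}\frac{\log\|a_n\|}{\lambda_n}=-\infty$ (so the series converges absolutely everywhere). Its maximum modulus is $M_f(\sigma)=\sup_{t\in\mathbb R}\|f(\sigma+it)\|$, and $M_f^{-1}$ is the inverse function of $M_f$. Iterated logarithms: $\log^{[0]}x=x$, $\log^{[-1]}x=\exp x$, $\log^{[k]}x=\log(\log^{[k-1]}x)$ for $k\ge1$. Index-pair: for $k\ge q+1\ge1$ let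 $\rho_f(k,q)=\limsup_{\sigma\to+\infty}\frac{\log^{[k]}M_f(\sigma)}{\log^{[q]}\sigma}$ (the same formula is used for shifted indices). $f$ has index-pair $(1,1)$ if $0<\rho_f(1,1)<\infty$; otherwise $f$ has index-pair $(k,q)\neq(1,1)$, $k\ge q+1\ge1$, if $\delta_{k-q,0}<\rho_f(k,q)<\infty$ and $\rho_f(k-1,q-1)$ is not a positive real number, where $\delta_{i,j}=1$ if $i=j$ and $0$ otherwise. Relative Ritt orders: if $f$ and $g$ have index-pairs $(k,q)$ and $(k,p)$ with $k\ge q+1\ge1$, $k\ge p+1\ge1$, then $$\rho_g^{(p,q)}(f)=\limsup_{\sigma\to+\infty}\frac{\log^{[p]}M_g^{-1}(M_f(\sigma))}{\log^{[q]}\sigma},\qquad \lambda_g^{(p,q)}(f)=\liminf_{\sigma\to+\infty}\frac{\log^{[p]}M_g^{-1}(M_f(\sigma))}{\log^{[q]}\sigma}$$ are the $(p,q)$-th relative Ritt order and lower order of $f$ with respect to $g$. In this situation $f$ has relative index-pair $(p,q)$ with respect to $g$ if $b<\rho_g^{(p,q)}(f)<\infty$ and $\rho_g^{(p-1,q-1)}(f)$ (same formula) is not a nonzero finite number, where $b=1$ if $p=q=k$ and $b=0$ otherwise. Relative types: if $0<\rho_g^{(p,q)}(f)<\infty$, the relative Ritt type $\Delta_g^{(p,q)}(f)$ and lower type $\overline{\Delta}_g^{(p,q)}(f)$ are respectively the $\limsup$ and the $\liminf$ as $\sigma\to+\infty$ of $$\frac{\log^{[p-1]}M_g^{-1}(M_f(\sigma))}{[\log^{[q-1]}\sigma]^{\rho_g^{(p,q)}(f)}}.$$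 If $0<\lambda_g^{(p,q)}(f)<\infty$, the relative Ritt weak type $\tau_g^{(p,q)}(f)$ and the indicator $\overline{\tau}_g^{(p,q)}(f)$ are respectively the $\liminf$ and the $\limsup$ as $\sigma\to+\infty$ of $$\frac{\log^{[p-1]}M_g^{-1}(M_f(\sigma))}{[\log^{[q-1]}\sigma]^{\lambda_g^{(p,q)}(f)}}.$$ For other pairs of functions and indices the definitions are the same with the letters changed. The claim presupposes that all quantities appearing in it are defined, i.e. the corresponding orders or lower orders are positive and finite. Convention: types lie in $[0,\infty]$; quotients are taken with $a/0=\infty$ for $a>0$ and $a/\infty=0$ for $a<\infty$, and relations are asserted when every quotient is meaningful (no $0/0$ or $\infty/\infty$). *)

theory Defs
  imports "HOL-Analysis.Analysis"
begin

text \<open>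
  Complex Banach spaces: real Banach spaces with a compatible complex scalar multiplication
  for which the norm is homogeneous.
\<close>

class complex_banach = banach +
  fixes scaleC :: "complex \<Rightarrow> 'a \<Rightarrow> 'a"
  assumes scaleC_add_right: "scaleC c (x + y) = scaleC c x + scaleC c y"
    and scaleC_add_left: "scaleC (c + d) x = scaleC c x + scaleC d x"
    and scaleC_scaleC: "scaleC c (scaleC d x) = scaleC (c * d) x"
    and scaleC_one: "scaleC 1 x = x"
    and scaleR_scaleC: "r *\<^sub>R x = scaleC (complex_of_real r) x"
    and norm_scaleC: "norm (scaleC c x) = cmod c * norm x"

instantiation complex :: complex_banach
begin

definition scaleC_complex :: "complex \<Rightarrow> complex \<Rightarrow> complex" where
  "scaleC_complex c x = c * x"

instance
  by standard (auto simp: scaleC_complex_def algebra_simps norm_mult scaleR_conv_of_real)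

end

text \<open>
  The sequences are indexed from 1; their values at 0 are irrelevant. The value of
  \<open>log \<parallel>a n\<parallel>\<close> is read as \<open>-\<infinity>\<close> when \<open>a n = 0\<close> (note that \<open>ln 0 = 0\<close> in HOL), so
  zero coefficients are allowed.
\<close>

definition vvds :: "(complex \<Rightarrow> 'e::complex_banach) \<Rightarrow> bool" where
  "vvds f \<longleftrightarrow>
     (\<exists>s. f s \<noteq> 0) \<and>
     (\<exists>(a :: nat \<Rightarrow> 'e) (lam :: nat \<Rightarrow> real).
        (\<forall>n\<ge>1. 0 < lam n \<and> lam n < lam (Suc n)) \<and>
        filterlim lam at_top sequentially \<and>
        limsup (\<lambda>n. ereal (ln (real n) / lam n)) < \<infinity> \<and>
        limsup (\<lambda>n. if a n = 0 then - \<infinity> else ereal (ln (norm (a n)) / lam n)) = - \<infinity> \<and>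
        (\<forall>s. (\<lambda>n. scaleC (exp (s * complex_of_real (lam (Suc n)))) (a (Suc n))) sums f s))"

definition max_mod :: "(complex \<Rightarrow> 'e::complex_banach) \<Rightarrow> real \<Rightarrow> real" where
  "max_mod f \<sigma> = (SUP t. norm (f (Complex \<sigma> t)))"

text \<open>
  For a function satisfying \<^const>\<open>vvds\<close>, \<open>max_mod f\<close> is an increasing bijection from the reals
  onto the positive reals; the following is its inverse there.
\<close>

definition max_mod_inv :: "(complex \<Rightarrow> 'e::complex_banach) \<Rightarrow> real \<Rightarrow> real" where
  "max_mod_inv f = inv (max_mod f)"

text \<open>Negative indices iterate \<open>exp\<close>; only the index \<open>-1\<close> is needed.\<close>

definition itlog :: "int \<Rightarrow> real \<Rightarrow> real" where
  "itlog k x = (if 0 \<le> k then (ln ^^ nat k) x else (exp ^^ nat (- k)) x)"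

definition ritt_order :: "(complex \<Rightarrow> 'e::complex_banach) \<Rightarrow> int \<Rightarrow> int \<Rightarrow> ereal" where
  "ritt_order f k q =
     Limsup at_top (\<lambda>\<sigma>::real. ereal (itlog k (max_mod f \<sigma>) / itlog q \<sigma>))"

definition index_pair :: "(complex \<Rightarrow> 'e::complex_banach) \<Rightarrow> int \<Rightarrow> int \<Rightarrow> bool" where
  "index_pair f k q \<longleftrightarrow>
     (if 0 < ritt_order f 1 1 \<and> ritt_order f 1 1 < \<infinity> then k = 1 \<and> q = 1
      else (k, q) \<noteq> (1, 1) \<and> k \<ge> q + 1 \<and> q + 1 \<ge> 1 \<and>
        (if k - q = 0 then 1 else 0) < ritt_order f k q \<and> ritt_order f k q < \<infinity> \<and>
        \<not> (0 < ritt_order f (k - 1) (q - 1) \<and> ritt_order f (k - 1) (q - 1) < \<infinity>))"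

text \<open>
  In the relative notions the first argument is the comparison function \<open>g\<close> and the second is
  \<open>f\<close>: \<open>rel_order g f p q\<close> is the \<open>(p,q)\<close>-th order of \<open>f\<close> with respect to \<open>g\<close>.
\<close>

definition rel_order ::
  "(complex \<Rightarrow> 'g::complex_banach) \<Rightarrow> (complex \<Rightarrow> 'f::complex_banach) \<Rightarrow> int \<Rightarrow> int \<Rightarrow> ereal" where
  "rel_order g f p q =
     Limsup at_top (\<lambda>\<sigma>::real. ereal (itlog p (max_mod_inv g (max_mod f \<sigma>)) / itlog q \<sigma>))"

definition rel_lower_order ::
  "(complex \<Rightarrow> 'g::complex_banach) \<Rightarrow> (complex \<Rightarrow> 'f::complex_banach) \<Rightarrow> int \<Rightarrow> int \<Rightarrow> ereal" where
  "rel_lower_order g f p q =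
     Liminf at_top (\<lambda>\<sigma>::real. ereal (itlog p (max_mod_inv g (max_mod f \<sigma>)) / itlog q \<sigma>))"

definition rel_index_pair ::
  "(complex \<Rightarrow> 'g::complex_banach) \<Rightarrow> (complex \<Rightarrow> 'f::complex_banach) \<Rightarrow> int \<Rightarrow> int \<Rightarrow> bool" where
  "rel_index_pair g f p q \<longleftrightarrow>
     (\<exists>k. k \<ge> q + 1 \<and> q + 1 \<ge> 1 \<and> k \<ge> p + 1 \<and> p + 1 \<ge> 1 \<and>
        index_pair f k q \<and> index_pair g k p \<and>
        (if p = k \<and> q = k then 1 else 0) < rel_order g f p q \<and> rel_order g f p q < \<infinity> \<and>
        \<not> (rel_order g f (p - 1) (q - 1) \<noteq> 0 \<and> \<bar>rel_order g f (p - 1) (q - 1)\<bar> \<noteq> \<infinity>))"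

text \<open>
  The types below are used only when the order (or lower order) in the exponent is positive
  and finite.
\<close>

definition rel_lower_type ::
  "(complex \<Rightarrow> 'g::complex_banach) \<Rightarrow> (complex \<Rightarrow> 'f::complex_banach) \<Rightarrow> int \<Rightarrow> int \<Rightarrow> ereal" where
  "rel_lower_type g f p q =
     Liminf at_top (\<lambda>\<sigma>::real. ereal (itlog (p - 1) (max_mod_inv g (max_mod f \<sigma>)) /
       itlog (q - 1) \<sigma> powr real_of_ereal (rel_order g f p q)))"

definition rel_weak_type ::
  "(complex \<Rightarrow> 'g::complex_banach) \<Rightarrow> (complex \<Rightarrow> 'f::complex_banach) \<Rightarrow> int \<Rightarrow> int \<Rightarrow> ereal" where
  "rel_weak_type g f p q =
     Liminf at_top (\<lambda>\<sigma>::real. ereal (itlog (p - 1) (max_mod_inv g (max_mod f \<sigma>)) /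
       itlog (q - 1) \<sigma> powr real_of_ereal (rel_lower_order g f p q)))"

definition rel_weak_type_sup ::
  "(complex \<Rightarrow> 'g::complex_banach) \<Rightarrow> (complex \<Rightarrow> 'f::complex_banach) \<Rightarrow> int \<Rightarrow> int \<Rightarrow> ereal" where
  "rel_weak_type_sup g f p q =
     Limsup at_top (\<lambda>\<sigma>::real. ereal (itlog (p - 1) (max_mod_inv g (max_mod f \<sigma>)) /
       itlog (q - 1) \<sigma> powr real_of_ereal (rel_lower_order g f p q)))"

text \<open>
  Division on \<^typ>\<open>ereal\<close> satisfies \<open>a / 0 = \<infinity>\<close> for \<open>a > 0\<close> and \<open>a / \<infinity> = 0\<close> for finite \<open>a\<close>;
  the quotients excluded here would otherwise silently take the value 0.
\<close>

definition meaningful_quotient :: "ereal \<Rightarrow> ereal \<Rightarrow> bool" where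
  "meaningful_quotient a b \<longleftrightarrow> \<not> (a = 0 \<and> b = 0) \<and> \<not> (a = \<infinity> \<and> b = \<infinity>)"

text \<open>Powers of elements of \<open>[0,\<infinity>]\<close> with a positive real exponent.\<close>

definition epowr :: "ereal \<Rightarrow> real \<Rightarrow> ereal" where
  "epowr x r = (if x = \<infinity> then \<infinity> else ereal (real_of_ereal x powr r))"

end

theory Submission
  imports Defs
begin

text \<open>
  With \<open>\<phi> = M_g\<^sup>-\<^sup>1 \<circ> M_f\<close> one has \<open>M_h\<^sup>-\<^sup>1 \<circ> M_f = (M_h\<^sup>-\<^sup>1 \<circ> M_g) \<circ> \<phi>\<close>. As \<open>\<phi>\<close> is an increasing bijection of the
  real line, every quantity attached to \<open>(h, g)\<close> can be computed along \<open>\<phi>(\<sigma>)\<close>, and all orders and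
  types become limits of quotients of powers of three functions \<open>a\<close>, \<open>c\<close>, \<open>d\<close> tending to infinity.
  The exponents in the types do not match a priori; what saves the two estimates are the
  inequalities \<open>\<lambda>_g(f) \<lambda>_h(g) \<le> \<lambda>_h(f) \<le> \<lambda>_g(f) \<rho>_h(g)\<close>, since \<open>d \<ge> 1\<close> eventually.

  That \<open>M_f\<close> is an increasing bijection onto the positive reals is shown without the maximum
  principle: the maximum modulus of a series with nonnegative exponents is convex and bounded on
  the left half-line, hence nondecreasing, and \<open>f\<close> is such a series times \<open>exp (\<mu> s)\<close>, \<open>\<mu> > 0\<close>.
\<close>

section \<open>Complex scalars and elementary real estimates\<close>

lemma scaleC_diff_left: "scaleC (c - d) x = scaleC c x - scaleC d (x::'a::complex_banach)"
  using scaleC_add_left[of "c - d" d x] by (simp add: algebra_simps)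

lemma scaleC_zero_right [simp]: "scaleC c (0::'a::complex_banach) = 0"
  by (metis mult_zero_right norm_eq_zero norm_scaleC)

text \<open>Odd powers cancel between \<open>exp x\<close> and \<open>exp (- x)\<close>, and the
  quadratic terms cancel against those of \<open>2 * cos x\<close>. Only the three Taylor remainders
  of order four survive.\<close>

lemma cosh_cos_bound:
  fixes x :: real
  shows "\<bar>exp x + exp (- x) + 2 * cos x - 4\<bar> \<le> x ^ 4 * exp \<bar>x\<bar>"
proof -
  obtain s where s: "\<bar>s\<bar> \<le> \<bar>x\<bar>"
      "exp x = (\<Sum>m<4. x ^ m / fact m) + exp s / fact 4 * x ^ 4"
    using Maclaurin_exp_le[of x 4] by auto
  obtain t where t: "\<bar>t\<bar> \<le> \<bar>- x\<bar>"
      "exp (- x) = (\<Sum>m<4. (- x) ^ m / fact m) + exp t / fact 4 * (- x) ^ 4"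
    using Maclaurin_exp_le[of "- x" 4] by metis
  obtain u where u: "cos x = (\<Sum>m<4. cos_coeff m * x ^ m) + cos (u + 1/2 * real 4 * pi) / fact 4 * x ^ 4"
    using Maclaurin_cos_expansion[of x 4] by blast
  define v where "v = cos (u + 1/2 * real 4 * pi)"
  have eq: "exp x + exp (- x) + 2 * cos x - 4 = (exp s + exp t + 2 * v) / 24 * x ^ 4"
    unfolding s(2) t(2) u v_def[symmetric]
    by (simp add: lessThan_nat_numeral fact_numeral cos_coeff_def field_simps power2_eq_square)
  have "\<bar>exp s + exp t + 2 * v\<bar> \<le> 24 * exp \<bar>x\<bar>"
  proof -
    have "exp s \<le> exp \<bar>x\<bar>" "exp t \<le> exp \<bar>x\<bar>" "1 \<le> exp \<bar>x\<bar>"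
      using s(1) t(1) by simp_all
    moreover have "\<bar>v\<bar> \<le> 1" by (simp add: v_def)
    moreover have "0 < exp s" "0 < exp t" by simp_all
    ultimately show ?thesis by linarith
  qed
  then have "\<bar>(exp s + exp t + 2 * v) / 24\<bar> * x ^ 4 \<le> exp \<bar>x\<bar> * x ^ 4"
    by (intro mult_right_mono) auto
  then show ?thesis
    unfolding eq by (simp add: abs_mult mult.commute)
qed

lemma pow4_le_exp:
  fixes x :: real
  assumes "0 \<le> x"
  shows "x ^ 4 \<le> 24 * exp x"
proof -
  obtain t where "exp x = (\<Sum>m<4. x ^ m / fact m) + exp t / fact 4 * x ^ 4" "\<bar>t\<bar> \<le> \<bar>x\<bar>"
    using Maclaurin_exp_le[of x 4] by auto
  have "x ^ 4 / fact 4 \<le> (\<Sum>m<5. x ^ m / fact m)"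
    using assms by (intro member_le_sum[where f = "\<lambda>m. x ^ m / fact m"]) auto
  also have "\<dots> \<le> exp x"
    using sum_le_suminf[OF summable_exp_generic, of "{..<5}" x] assms
    by (auto simp: exp_def field_simps)
  finally show ?thesis by (simp add: fact_numeral)
qed

text \<open>If \<open>\<phi> b < \<phi> x\<close>, a linear tilt and a small quadratic term produce
  \<open>w\<close> with an interior maximum \<open>y\<close>. Maximality forces the second
  difference of \<open>\<phi>\<close> at \<open>y\<close> down to
  \<open>- 2 * n * r\<^sup>2\<close>, which for small \<open>r\<close> exceeds the permitted defect
  \<open>C * r ^ 4\<close>.\<close>

lemma approx_convex_imp_le:
  fixes \<phi> :: "real \<Rightarrow> real"
  assumes cont: "continuous_on UNIV \<phi>"
    and bdd: "\<And>x. x \<le> b \<Longrightarrow> \<phi> x \<le> B"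
    and conv: "\<And>x. \<exists>C. \<forall>r. 0 \<le> r \<and> r \<le> 1 \<longrightarrow> 2 * \<phi> x \<le> \<phi> (x + r) + \<phi> (x - r) + C * r ^ 4"
    and "x \<le> b"
  shows "\<phi> x \<le> \<phi> b"
proof (rule ccontr)
  assume "\<not> \<phi> x \<le> \<phi> b"
  then have less: "\<phi> b < \<phi> x" by simp
  with \<open>x \<le> b\<close> have "x < b" by (cases "x = b") auto
  \<comment> \<open>This slope lets the tilt consume exactly half of the gap between
    \<open>\<phi> x\<close> and \<open>\<phi> b\<close>, so \<open>w x\<close> stays above
    \<open>w b\<close>.\<close>
  define e where "e = (\<phi> x - \<phi> b) / (2 * (b - x))"
  have "0 < e" using less \<open>x < b\<close> by (simp add: e_def)
  have "\<phi> b \<le> B" using bdd by simp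
  \<comment> \<open>Since \<open>e * R = B - \<phi> b + 2\<close> and, with \<open>n\<close> below,
    \<open>n * R\<^sup>2 = 1\<close>, the value of \<open>w\<close> at \<open>b - R\<close> is at
    most \<open>\<phi> b - 1\<close>.\<close>
  define R where "R = (B - \<phi> b + 2) / e"
  have "0 < R" using \<open>\<phi> b \<le> B\<close> \<open>0 < e\<close> by (simp add: R_def)
  define n where "n = 1 / R\<^sup>2"
  have "0 < n" using \<open>0 < R\<close> by (simp add: n_def)
  define w where "w = (\<lambda>y. \<phi> y + e * (y - b) + n * (y - b)\<^sup>2)"
  have "continuous_on {b - R..b} w"
    unfolding w_def by (intro continuous_intros continuous_on_subset[OF cont]) auto
  then obtain y where y: "y \<in> {b - R..b}" "\<And>z. z \<in> {b - R..b} \<Longrightarrow> w z \<le> w y"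
    using continuous_attains_sup[of "{b - R..b}" w] \<open>0 < R\<close> by auto
  have wb: "w b = \<phi> b" by (simp add: w_def)
  have wA: "w (b - R) < \<phi> b"
  proof -
    have "e * R = B - \<phi> b + 2"
      using \<open>0 < e\<close> by (simp add: R_def)
    moreover have "n * R\<^sup>2 = 1"
      using \<open>0 < R\<close> by (simp add: n_def)
    ultimately show ?thesis
      using bdd[of "b - R"] \<open>0 < R\<close> by (simp add: w_def)
  qed
  have ex: "e * (x - b) = (\<phi> b - \<phi> x) / 2"
    using \<open>x < b\<close> by (simp add: e_def field_simps)
  have wx: "\<phi> b < w x"
  proof -
    have "0 \<le> n * (x - b)\<^sup>2" using \<open>0 < n\<close> by simp
    with ex less show ?thesis
      unfolding w_def by argo
  qed
  have "b - R \<le> x"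
  proof (rule ccontr)
    assume "\<not> b - R \<le> x"
    then have "e * R < e * (b - x)" using \<open>0 < e\<close> by simp
    moreover have "e * R = B - \<phi> b + 2" using \<open>0 < e\<close> by (simp add: R_def)
    moreover have "e * (b - x) = (\<phi> x - \<phi> b) / 2" using ex by argo
    ultimately have "B - \<phi> b + 2 < (\<phi> x - \<phi> b) / 2" by linarith
    with bdd[OF \<open>x \<le> b\<close>] \<open>\<phi> b \<le> B\<close> show False by argo
  qed
  then have "w x \<le> w y" using y(2) \<open>x \<le> b\<close> by simp
  then have "y \<noteq> b" "y \<noteq> b - R" using wx wb wA by auto
  then have int: "b - R < y" "y < b" using y(1) by auto
  obtain C where C: "\<And>r. 0 \<le> r \<Longrightarrow> r \<le> 1 \<Longrightarrow> 2 * \<phi> y \<le> \<phi> (y + r) + \<phi> (y - r) + C * r ^ 4"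
    using conv[of y] by blast
  define D where "D = max C 1"
  \<comment> \<open>\<open>r \<le> 1\<close> permits the use of \<open>C\<close>,
    \<open>n / D\<close> gives \<open>D * r \<le> n\<close>, and the last two bounds keep
    \<open>y + r\<close> and \<open>y - r\<close> inside the interval.\<close>
  define r where "r = min (min 1 (n / D)) (min (b - y) (y - (b - R)))"
  have "0 < D" "C \<le> D" by (auto simp: D_def)
  have r: "0 < r" "r \<le> 1" "r \<le> n / D" "r \<le> b - y" "r \<le> y - (b - R)"
    using int \<open>0 < n\<close> \<open>0 < D\<close> by (auto simp: r_def)
  have "w (y + r) \<le> w y" "w (y - r) \<le> w y" using r by (auto intro!: y(2))
  then have "\<phi> (y + r) + \<phi> (y - r) + 2 * n * r\<^sup>2 \<le> 2 * \<phi> y"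
    by (simp add: w_def power2_eq_square algebra_simps)
  with C[of r] r have "2 * n * r\<^sup>2 \<le> C * r ^ 4" by simp
  also have "\<dots> \<le> D * r ^ 4" by (intro mult_right_mono \<open>C \<le> D\<close>) simp
  also have "\<dots> = D * r * (r\<^sup>2 * r)" by (simp add: power4_eq_xxxx power2_eq_square)
  also have "\<dots> \<le> n * (r\<^sup>2 * r)"
    using r(1,3) \<open>0 < D\<close> by (intro mult_right_mono) (simp_all add: pos_le_divide_eq mult.commute)
  also have "\<dots> \<le> n * r\<^sup>2" using r \<open>0 < n\<close> by (simp add: mult_left_le)
  finally show False using r \<open>0 < n\<close> by simp
qed

section \<open>Maximum modulus of a Dirichlet series with nonnegative exponents\<close>

text \<open>Instantiated both with the expansion of \<open>f\<close> and with \<open>f\<close>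
  divided by its leading exponential, whose exponents start at 0.\<close>

locale dirichlet_series =
  fixes b :: "nat \<Rightarrow> 'e::complex_banach" and \<nu> :: "nat \<Rightarrow> real" and F :: "complex \<Rightarrow> 'e"
  assumes exponent_nonneg: "0 \<le> \<nu> n"
    and summable_coeff: "summable (\<lambda>n. norm (b n) * exp (x * \<nu> n))"
    and expansion: "(\<lambda>n. scaleC (exp (s * complex_of_real (\<nu> n))) (b n)) sums F s"
begin

definition majorant :: "real \<Rightarrow> real" where
  "majorant x = (\<Sum>n. norm (b n) * exp (x * \<nu> n))"

text \<open>Reduces estimates of values, differences and averages of \<open>F\<close> to termwise
  estimates of scalar multipliers. Polynomial factors in \<open>\<nu> n\<close> are absorbed by
  moving \<open>x\<close> to the right, as the coefficients are summable at every abscissa.\<close>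

lemma norm_le_majorant:
  assumes "(\<lambda>n. scaleC (w n) (b n)) sums X"
    and "\<And>n. norm (w n) \<le> K * exp (x * \<nu> n)"
  shows "norm X \<le> K * majorant x"
proof -
  have "norm (\<Sum>n. scaleC (w n) (b n)) \<le> (\<Sum>n. K * (norm (b n) * exp (x * \<nu> n)))"
  proof (rule norm_suminf_le)
    show "norm (scaleC (w n) (b n)) \<le> K * (norm (b n) * exp (x * \<nu> n))" for n
      using mult_right_mono[OF assms(2)[of n] norm_ge_zero[of "b n"]]
      by (simp add: norm_scaleC algebra_simps)
  qed (intro summable_mult summable_coeff)
  then show ?thesis
    using assms(1) summable_coeff[of x] by (simp add: sums_iff majorant_def suminf_mult)
qed

lemma majorant_mono: "x \<le> y \<Longrightarrow> majorant x \<le> majorant y"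
  unfolding majorant_def
  by (intro suminf_le summable_coeff mult_left_mono) (auto simp: exponent_nonneg mult_right_mono)

lemma norm_le: "norm (F (Complex \<sigma> t)) \<le> majorant \<sigma>"
  using norm_le_majorant[OF expansion[of "Complex \<sigma> t"], of 1 \<sigma>] by simp

lemma bdd_above_norm: "bdd_above (range (\<lambda>t. norm (F (Complex \<sigma> t))))"
  using norm_le by (intro bdd_aboveI2)

lemma norm_le_max_mod: "norm (F (Complex \<sigma> t)) \<le> max_mod F \<sigma>"
  unfolding max_mod_def by (intro cSUP_upper bdd_above_norm) auto

lemma max_mod_le: "(\<And>t. norm (F (Complex \<sigma> t)) \<le> K) \<Longrightarrow> max_mod F \<sigma> \<le> K"
  unfolding max_mod_def by (intro cSUP_least) auto

text \<open>Points at the same height \<open>t\<close> are compared termwise. The resulting bound is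
  uniform in \<open>t\<close> and so passes to the suprema.\<close>

lemma max_mod_diff_le:
  assumes "x \<le> y"
  shows "\<bar>max_mod F x - max_mod F y\<bar> \<le> (y - x) * majorant (y + 1)"
proof -
  have *: "norm (F (Complex x t) - F (Complex y t)) \<le> (y - x) * majorant (y + 1)" for t
  proof (rule norm_le_majorant)
    let ?w = "\<lambda>n. exp (Complex x t * complex_of_real (\<nu> n)) - exp (Complex y t * complex_of_real (\<nu> n))"
    show "(\<lambda>n. scaleC (?w n) (b n)) sums (F (Complex x t) - F (Complex y t))"
      unfolding scaleC_diff_left by (intro sums_diff expansion)
    show "norm (?w n) \<le> (y - x) * exp ((y + 1) * \<nu> n)" for n
    proof -
      have "Complex z t * complex_of_real (\<nu> n) = of_real (z * \<nu> n) + \<i> * of_real (t * \<nu> n)" for z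
        by (simp add: complex_eq_iff)
      then have "?w n = of_real (exp (x * \<nu> n) - exp (y * \<nu> n)) * cis (t * \<nu> n)"
        by (simp add: exp_add cis_conv_exp exp_of_real[symmetric] algebra_simps)
      then have "norm (?w n) = exp (y * \<nu> n) - exp (x * \<nu> n)"
        using \<open>x \<le> y\<close> exponent_nonneg[of n]
        by (simp add: norm_mult mult_right_mono del: of_real_diff of_real_exp)
      \<comment> \<open>This is \<open>1 + u \<le> exp u\<close> at
        \<open>u = (x - y) * \<nu> n\<close>, multiplied by \<open>exp (y * \<nu> n)\<close>. The
        factor \<open>\<nu> n\<close> is next bounded by \<open>exp (\<nu> n)\<close>, hence the
        abscissa \<open>y + 1\<close>.\<close>
      also have "\<dots> \<le> exp (y * \<nu> n) * ((y - x) * \<nu> n)"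
        using exp_ge_add_one_self[of "(x - y) * \<nu> n"] mult_left_mono[of "1 + (x - y) * \<nu> n" "exp ((x - y) * \<nu> n)" "exp (y * \<nu> n)"]
        by (simp add: exp_add[symmetric] algebra_simps)
      also have "\<dots> \<le> exp (y * \<nu> n) * ((y - x) * exp (\<nu> n))"
      proof -
        have "\<nu> n \<le> exp (\<nu> n)" using exp_ge_add_one_self[of "\<nu> n"] by linarith
        then show ?thesis using \<open>x \<le> y\<close> by (intro mult_left_mono) auto
      qed
      also have "\<dots> = (y - x) * exp ((y + 1) * \<nu> n)"
        by (simp add: exp_add algebra_simps)
      finally show ?thesis .
    qed
  qed
  have "max_mod F x \<le> max_mod F y + (y - x) * majorant (y + 1)"
  proof (rule max_mod_le)
    show "norm (F (Complex x t)) \<le> max_mod F y + (y - x) * majorant (y + 1)" for t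
      using *[of t] norm_le_max_mod[of y t] norm_triangle_ineq2[of "F (Complex x t)" "F (Complex y t)"]
      by linarith
  qed
  moreover have "max_mod F y \<le> max_mod F x + (y - x) * majorant (y + 1)"
  proof (rule max_mod_le)
    show "norm (F (Complex y t)) \<le> max_mod F x + (y - x) * majorant (y + 1)" for t
      using *[of t] norm_le_max_mod[of x t] norm_triangle_ineq3[of "F (Complex x t)" "F (Complex y t)"]
      by linarith
  qed
  ultimately show ?thesis by linarith
qed

lemma continuous_on_max_mod: "continuous_on UNIV (max_mod F)"
proof (rule continuous_at_imp_continuous_on, safe)
  fix x :: real
  have "((\<lambda>y. max_mod F y - max_mod F x) \<longlongrightarrow> 0) (at x)"
  proof (rule Lim_null_comparison)
    have "\<forall>\<^sub>F y in at x. dist y x < 1"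
      unfolding eventually_at by (intro exI[of _ 1]) auto
    then show "\<forall>\<^sub>F y in at x. norm (max_mod F y - max_mod F x) \<le> \<bar>y - x\<bar> * majorant (x + 2)"
    proof eventually_elim
      case (elim y)
      have "\<bar>max_mod F y - max_mod F x\<bar> \<le> \<bar>y - x\<bar> * majorant (max x y + 1)"
        using max_mod_diff_le[of x y] max_mod_diff_le[of y x] by (cases "x \<le> y") auto
      also have "\<dots> \<le> \<bar>y - x\<bar> * majorant (x + 2)"
        using elim by (intro mult_left_mono majorant_mono) (auto simp: dist_real_def)
      finally show ?case by simp
    qed
    show "((\<lambda>y. \<bar>y - x\<bar> * majorant (x + 2)) \<longlongrightarrow> 0) (at x)"
      by (auto intro!: tendsto_eq_intros)
  qed
  then show "isCont (max_mod F) x"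
    by (simp add: isCont_def LIM_zero_iff)
qed

text \<open>
  Averaging \<open>exp (s \<nu>)\<close> over the four points \<open>s \<plusminus> r\<close>, \<open>s \<plusminus> \<i> r\<close> reproduces its value
  up to \<open>O(r^4)\<close>; the shifts by \<open>\<plusminus> \<i> r\<close> do not leave the vertical line.
\<close>

lemma max_mod_approx_convex:
  assumes "0 \<le> r" "r \<le> 1"
  shows "2 * max_mod F \<sigma> \<le> max_mod F (\<sigma> + r) + max_mod F (\<sigma> - r) + 24 * majorant (\<sigma> + 2) * r ^ 4"
proof -
  let ?E = "\<lambda>x y n. exp (Complex x y * complex_of_real (\<nu> n))"
  have bound: "norm (F (Complex (\<sigma> + r) t) + F (Complex (\<sigma> - r) t) + F (Complex \<sigma> (t + r)) + F (Complex \<sigma> (t - r))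
      - 4 *\<^sub>R F (Complex \<sigma> t)) \<le> (24 * r ^ 4) * majorant (\<sigma> + 2)" for t
  proof (rule norm_le_majorant)
    let ?w = "\<lambda>n. ?E (\<sigma> + r) t n + ?E (\<sigma> - r) t n + ?E \<sigma> (t + r) n + ?E \<sigma> (t - r) n
       - complex_of_real 4 * ?E \<sigma> t n"
    show "(\<lambda>n. scaleC (?w n) (b n)) sums (F (Complex (\<sigma> + r) t) + F (Complex (\<sigma> - r) t)
        + F (Complex \<sigma> (t + r)) + F (Complex \<sigma> (t - r)) - 4 *\<^sub>R F (Complex \<sigma> t))"
      unfolding scaleC_diff_left scaleC_add_left scaleC_scaleC[symmetric] scaleR_scaleC[symmetric]
      by (intro sums_diff sums_add sums_scaleR_right expansion)
    show "norm (?w n) \<le> 24 * r ^ 4 * exp ((\<sigma> + 2) * \<nu> n)" for n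
    proof -
      define x where "x = r * \<nu> n"
      have x: "0 \<le> x" "x \<le> \<nu> n"
        using assms exponent_nonneg[of n] by (auto simp: x_def mult_le_cancel_right1 mult_left_le_one_le)
      have "Complex (\<sigma> + r) t * \<nu> n = Complex \<sigma> t * \<nu> n + of_real x"
        "Complex (\<sigma> - r) t * \<nu> n = Complex \<sigma> t * \<nu> n + of_real (- x)"
        "Complex \<sigma> (t + r) * \<nu> n = Complex \<sigma> t * \<nu> n + \<i> * of_real x"
        "Complex \<sigma> (t - r) * \<nu> n = Complex \<sigma> t * \<nu> n + \<i> * of_real (- x)"
        by (simp_all add: complex_eq_iff x_def algebra_simps)
      then have "?w n = ?E \<sigma> t n * (of_real (exp x) + of_real (exp (- x)) + cis x + cis (- x) - 4)"
        by (simp only: exp_add cis_conv_exp exp_of_real) (simp add: algebra_simps)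
      also have "of_real (exp x) + of_real (exp (- x)) + cis x + cis (- x) - 4
          = complex_of_real (exp x + exp (- x) + 2 * cos x - 4)"
        by (simp add: complex_eq_iff del: of_real_exp)
      finally have "norm (?w n) = exp (\<sigma> * \<nu> n) * \<bar>exp x + exp (- x) + 2 * cos x - 4\<bar>"
        by (simp only: norm_mult norm_of_real norm_exp_eq_Re) simp
      also have "\<dots> \<le> exp (\<sigma> * \<nu> n) * (x ^ 4 * exp \<bar>x\<bar>)"
        by (intro mult_left_mono cosh_cos_bound) auto
      \<comment> \<open>Here \<open>x = r * \<nu> n\<close>: the power gives
        \<open>r ^ 4 * 24 * exp (\<nu> n)\<close> and the remainder another
        \<open>exp (\<nu> n)\<close>, which shifts the abscissa by 2.\<close>
      also have "\<dots> \<le> exp (\<sigma> * \<nu> n) * ((r ^ 4 * (24 * exp (\<nu> n))) * exp (\<nu> n))"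
        using x assms pow4_le_exp[OF exponent_nonneg[of n]]
        by (intro mult_left_mono mult_mono) (auto simp: x_def power_mult_distrib mult_left_mono)
      also have "\<dots> = 24 * r ^ 4 * exp ((\<sigma> + 2) * \<nu> n)"
      proof -
        have "exp ((\<sigma> + 2) * \<nu> n) = exp (\<sigma> * \<nu> n) * exp (\<nu> n) * exp (\<nu> n)"
          by (simp add: exp_add[symmetric] algebra_simps)
        then show ?thesis by simp
      qed
      finally show ?thesis .
    qed
  qed
  \<comment> \<open>The two vertically shifted points contribute at most
    \<open>max_mod F \<sigma>\<close> each. Subtracting these two copies from the four on the left
    leaves the claim.\<close>
  have "max_mod F \<sigma> \<le> (max_mod F (\<sigma> + r) + max_mod F (\<sigma> - r) + 2 * max_mod F \<sigma> + 24 * r ^ 4 * majorant (\<sigma> + 2)) / 4"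
  proof (rule max_mod_le)
    fix t
    let ?a = "F (Complex (\<sigma> + r) t)" and ?b = "F (Complex (\<sigma> - r) t)"
      and ?c = "F (Complex \<sigma> (t + r))" and ?d = "F (Complex \<sigma> (t - r))"
    let ?R = "?a + ?b + ?c + ?d - 4 *\<^sub>R F (Complex \<sigma> t)"
    have "4 * norm (F (Complex \<sigma> t)) = norm (?a + ?b + ?c + ?d - ?R)" by simp
    also have "\<dots> \<le> norm ?a + norm ?b + norm ?c + norm ?d + norm ?R"
      using norm_triangle_ineq4[of "?a + ?b + ?c + ?d" ?R] norm_triangle_ineq[of "?a + ?b + ?c" ?d]
        norm_triangle_ineq[of "?a + ?b" ?c] norm_triangle_ineq[of ?a ?b] by linarith
    finally have "4 * norm (F (Complex \<sigma> t))
        \<le> max_mod F (\<sigma> + r) + max_mod F (\<sigma> - r) + 2 * max_mod F \<sigma> + 24 * r ^ 4 * majorant (\<sigma> + 2)"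
      using bound[of t] norm_le_max_mod[of "\<sigma> + r" t] norm_le_max_mod[of "\<sigma> - r" t]
        norm_le_max_mod[of \<sigma> "t + r"] norm_le_max_mod[of \<sigma> "t - r"] by linarith
    then show "norm (F (Complex \<sigma> t))
        \<le> (max_mod F (\<sigma> + r) + max_mod F (\<sigma> - r) + 2 * max_mod F \<sigma> + 24 * r ^ 4 * majorant (\<sigma> + 2)) / 4"
      by simp
  qed
  then show ?thesis by (simp add: field_simps)
qed

lemma max_mod_mono: "x \<le> y \<Longrightarrow> max_mod F x \<le> max_mod F y"
proof (rule approx_convex_imp_le[OF continuous_on_max_mod])
  show "max_mod F z \<le> majorant y" if "z \<le> y" for z
    using norm_le order_trans[OF _ majorant_mono[OF that]] by (intro max_mod_le) blast
  show "\<exists>C. \<forall>r. 0 \<le> r \<and> r \<le> 1 \<longrightarrow> 2 * max_mod F z \<le> max_mod F (z + r) + max_mod F (z - r) + C * r ^ 4" for z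
    using max_mod_approx_convex by blast
qed

text \<open>A zero of the maximum modulus would propagate to the whole left half-line by
  monotonicity, whereas \<open>F\<close> tends to \<open>b 0\<close> there.\<close>

lemma max_mod_pos:
  assumes "\<nu> 0 = 0" and "b 0 \<noteq> 0" and "0 < \<mu>" and gap: "\<And>n. 0 < n \<Longrightarrow> \<mu> \<le> \<nu> n"
  shows "0 < max_mod F \<sigma>"
proof (rule ccontr)
  assume "\<not> 0 < max_mod F \<sigma>"
  have zero: "F (of_real x) = 0" if "x \<le> \<sigma>" for x
  proof -
    have "norm (F (Complex x 0)) \<le> 0"
      using max_mod_mono[OF that] norm_le_max_mod[of x 0] \<open>\<not> 0 < max_mod F \<sigma>\<close> by linarith
    then show ?thesis by (simp add: complex_of_real_def)
  qed
  \<comment> \<open>All terms but the first have exponent at least \<open>\<mu>\<close>, so for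
    \<open>x \<le> 0\<close> the remainder \<open>F - b 0\<close> carries the factor
    \<open>exp (x * \<mu>)\<close>.\<close>
  have le: "norm (b 0) \<le> exp (x * \<mu>) * majorant 0" if "x \<le> \<sigma>" "x \<le> 0" for x
  proof -
    have "norm (F (of_real x) - b 0) \<le> exp (x * \<mu>) * majorant 0"
    proof (rule norm_le_majorant)
      let ?w = "\<lambda>n. exp (of_real x * complex_of_real (\<nu> n)) - (if n = 0 then 1 else 0)"
      have eq: "(\<lambda>n. scaleC (if n = 0 then 1 else 0) (b n)) = (\<lambda>n. if n = 0 then b n else 0)"
        using scaleC_diff_left[of 1 1] by (auto simp: fun_eq_iff scaleC_one)
      have "(\<lambda>n. scaleC (if n = 0 then 1 else 0) (b n)) sums b 0"
        unfolding eq by (rule sums_single)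
      then show "(\<lambda>n. scaleC (?w n) (b n)) sums (F (of_real x) - b 0)"
        unfolding scaleC_diff_left by (intro sums_diff expansion)
      show "norm (?w n) \<le> exp (x * \<mu>) * exp (0 * \<nu> n)" for n
        using gap[of n] \<open>\<nu> 0 = 0\<close> \<open>x \<le> 0\<close> by (cases "n = 0") (auto simp: mult_left_mono_neg)
    qed
    then show ?thesis using zero[OF \<open>x \<le> \<sigma>\<close>] by simp
  qed
  have "\<forall>\<^sub>F x in at_bot. norm (b 0) \<le> exp (x * \<mu>) * majorant 0"
    using eventually_le_at_bot[of "min \<sigma> 0"] by (rule eventually_mono) (simp add: le)
  moreover have "((\<lambda>x. exp (x * \<mu>) * majorant 0) \<longlongrightarrow> 0) at_bot"
  proof (intro tendsto_mult_left_zero filterlim_compose[OF exp_at_bot])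
    show "filterlim (\<lambda>x. x * \<mu>) at_bot at_bot"
      using filterlim_tendsto_pos_mult_at_bot[OF tendsto_const \<open>0 < \<mu>\<close> filterlim_ident]
      by (simp add: mult.commute)
  qed
  ultimately have "norm (b 0) \<le> 0"
    by (intro tendsto_lowerbound) auto
  with \<open>b 0 \<noteq> 0\<close> show False by simp
qed

end

section \<open>The maximum modulus of a VVDS as a bijection onto the positive reals\<close>

lemma bounded_linear_scaleC: "bounded_linear (scaleC c :: 'a::complex_banach \<Rightarrow> 'a)"
proof (rule bounded_linear_intro)
  show "scaleC c (r *\<^sub>R x) = r *\<^sub>R scaleC c x" for r and x :: 'a
    by (simp add: scaleR_scaleC scaleC_scaleC mult.commute)
  show "norm (scaleC c x) \<le> norm x * cmod c" for x :: 'a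
    by (simp add: norm_scaleC mult.commute)
qed (rule scaleC_add_right)

text \<open>With \<open>ln n \<le> K * lam n\<close> eventually, the decay condition is used at the
  level \<open>- (x + 2 * K)\<close>: it cancels \<open>exp (x * lam n)\<close> and leaves a term of
  size at most \<open>1 / n ^ 2\<close>.\<close>

lemma summable_vvds_coeff:
  fixes a :: "nat \<Rightarrow> 'e::complex_banach"
  assumes pos: "\<And>n. 1 \<le> n \<Longrightarrow> 0 < lam n"
    and density: "limsup (\<lambda>n. ereal (ln (real n) / lam n)) < \<infinity>"
    and decay: "limsup (\<lambda>n. if a n = 0 then - \<infinity> else ereal (ln (norm (a n)) / lam n)) = - \<infinity>"
  shows "summable (\<lambda>n. norm (a n) * exp (x * lam n))"
proof -
  obtain K :: nat where K: "limsup (\<lambda>n. ereal (ln (real n) / lam n)) < ereal (real K)"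
    using density less_PInf_Ex_of_nat by auto
  have D: "limsup (\<lambda>n. if a n = 0 then - \<infinity> else ereal (ln (norm (a n)) / lam n)) < ereal (- (x + 2 * K))"
    by (simp add: decay)
  have "\<forall>\<^sub>F n in sequentially. norm (norm (a n) * exp (x * lam n)) \<le> inverse (real n ^ 2)"
    using Limsup_lessD[OF K] Limsup_lessD[OF D] eventually_ge_at_top[of 1]
  proof eventually_elim
    case (elim n)
    have lam: "0 < lam n" using pos elim by simp
    show ?case
    proof (cases "a n = 0")
      case False
      then have "ln (norm (a n)) \<le> - (x + 2 * K) * lam n"
        using elim(2) lam by (simp add: field_simps)
      moreover have "ln (real n) \<le> K * lam n"
        using elim(1) lam by (simp add: field_simps)
      ultimately have "ln (norm (a n)) + x * lam n \<le> - (2 * ln (real n))"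
        by (simp add: algebra_simps)
      then have "exp (ln (norm (a n)) + x * lam n) \<le> exp (- (2 * ln (real n)))"
        by simp
      also have "\<dots> = inverse (real n ^ 2)"
        using elim(3) by (simp add: exp_minus exp_double)
      finally show ?thesis using False by (simp add: exp_add)
    qed simp
  qed
  then show ?thesis
    by (rule summable_comparison_test_ev) (rule inverse_power_summable, simp)
qed

lemma vvds_expansion:
  fixes f :: "complex \<Rightarrow> 'e::complex_banach"
  assumes "vvds f"
  obtains b \<mu> where "strict_mono \<mu>" "0 < \<mu> 0" "b 0 \<noteq> 0" "dirichlet_series b \<mu> f"
proof -
  obtain a lam where
      lam: "\<And>n. 1 \<le> n \<Longrightarrow> 0 < lam n \<and> lam n < lam (Suc n)"
    and density: "limsup (\<lambda>n. ereal (ln (real n) / lam n)) < \<infinity>"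
    and decay: "limsup (\<lambda>n. if a n = 0 then - \<infinity> else ereal (ln (norm (a n)) / lam n)) = - \<infinity>"
    and sums: "\<And>s. (\<lambda>n. scaleC (exp (s * complex_of_real (lam (Suc n)))) (a (Suc n))) sums f s"
    and nonzero: "\<exists>s. f s \<noteq> 0"
    using assms unfolding vvds_def by blast
  have "\<exists>n. a (Suc n) \<noteq> 0"
  proof (rule ccontr)
    assume "\<not> ?thesis"
    then have "f s = 0" for s using sums[of s] sums_unique2[OF _ sums_zero] by simp
    with nonzero show False by blast
  qed
  \<comment> \<open>The expansion restarts at the first nonzero coefficient, so that the leading
    exponential can be factored out. The original sequences start at 1, hence
    \<open>Suc\<close>.\<close>
  define N where "N = (LEAST n. a (Suc n) \<noteq> 0)"
  have N: "a (Suc N) \<noteq> 0" "\<And>n. n < N \<Longrightarrow> a (Suc n) = 0"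
    unfolding N_def using LeastI_ex[OF \<open>\<exists>n. a (Suc n) \<noteq> 0\<close>] not_less_Least by blast+
  show thesis
  proof
    show "strict_mono (\<lambda>n. lam (Suc (n + N)))"
      using lam by (simp add: strict_mono_Suc_iff)
    show "0 < lam (Suc (0 + N))" "a (Suc (0 + N)) \<noteq> 0" using lam N by simp_all
    show "dirichlet_series (\<lambda>n. a (Suc (n + N))) (\<lambda>n. lam (Suc (n + N))) f"
    proof
      show "0 \<le> lam (Suc (n + N))" for n using lam[of "Suc (n + N)"] by simp
      show "summable (\<lambda>n. norm (a (Suc (n + N))) * exp (x * lam (Suc (n + N))))" for x
        using summable_ignore_initial_segment[OF summable_vvds_coeff[OF _ density decay, of x], of "Suc N"] lam
        by simp
      show "(\<lambda>n. scaleC (exp (s * complex_of_real (lam (Suc (n + N))))) (a (Suc (n + N)))) sums f s" for s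
        using sums[of s] N(2)
        by (subst sums_zero_iff_shift[where f = "\<lambda>n. scaleC (exp (s * complex_of_real (lam (Suc n)))) (a (Suc n))"]) auto
    qed
  qed
qed

text \<open>Division by \<open>exp (\<mu> 0 * s)\<close> lowers every exponent by
  \<open>\<mu> 0\<close>. As the modulus of this exponential is constant on vertical lines, the
  maximum modulus merely loses the factor \<open>exp (\<mu> 0 * \<sigma>)\<close>, and
  \<open>k\<close> is that of the quotient.\<close>

lemma vvds_max_mod_factor:
  fixes f :: "complex \<Rightarrow> 'e::complex_banach"
  assumes "vvds f"
  obtains \<mu> k where "0 < \<mu>" "\<And>\<sigma>. max_mod f \<sigma> = exp (\<mu> * \<sigma>) * k \<sigma>" "mono k" "\<And>\<sigma>. 0 < k \<sigma>"
    "continuous_on UNIV (max_mod f)"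
proof -
  obtain b \<mu> where \<mu>: "strict_mono \<mu>" "0 < \<mu> 0" "b 0 \<noteq> 0" and f: "dirichlet_series b \<mu> f"
    using vvds_expansion[OF assms] by blast
  interpret f: dirichlet_series b \<mu> f by (rule f)
  define F where "F = (\<lambda>s. scaleC (exp (- s * complex_of_real (\<mu> 0))) (f s))"
  interpret F: dirichlet_series b "\<lambda>n. \<mu> n - \<mu> 0" F
  proof
    show "0 \<le> \<mu> n - \<mu> 0" for n using \<mu>(1) by (simp add: strict_mono_less_eq)
    show "summable (\<lambda>n. norm (b n) * exp (x * (\<mu> n - \<mu> 0)))" for x
      using summable_mult[OF f.summable_coeff[of x], of "exp (- x * \<mu> 0)"]
      by (simp add: exp_diff exp_minus field_simps)
    show "(\<lambda>n. scaleC (exp (s * complex_of_real (\<mu> n - \<mu> 0))) (b n)) sums F s" for s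
      using bounded_linear.sums[OF bounded_linear_scaleC f.expansion[of s], of "exp (- s * complex_of_real (\<mu> 0))"]
      by (simp add: F_def scaleC_scaleC exp_add[symmetric] algebra_simps)
  qed
  have norm_f: "norm (f (Complex \<sigma> t)) = exp (\<mu> 0 * \<sigma>) * norm (F (Complex \<sigma> t))" for \<sigma> t
  proof -
    have "norm (F (Complex \<sigma> t)) = exp (- (\<mu> 0 * \<sigma>)) * norm (f (Complex \<sigma> t))"
      by (simp add: F_def norm_scaleC mult.commute)
    then show ?thesis by (simp add: exp_minus)
  qed
  have eq: "max_mod f \<sigma> = exp (\<mu> 0 * \<sigma>) * max_mod F \<sigma>" for \<sigma>
  proof (rule antisym)
    show "max_mod f \<sigma> \<le> exp (\<mu> 0 * \<sigma>) * max_mod F \<sigma>"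
      by (intro f.max_mod_le) (simp add: norm_f F.norm_le_max_mod)
    have "max_mod F \<sigma> \<le> max_mod f \<sigma> / exp (\<mu> 0 * \<sigma>)"
      using f.norm_le_max_mod by (intro F.max_mod_le) (simp add: pos_le_divide_eq norm_f mult.commute)
    then show "exp (\<mu> 0 * \<sigma>) * max_mod F \<sigma> \<le> max_mod f \<sigma>"
      by (simp add: pos_le_divide_eq mult.commute)
  qed
  \<comment> \<open>Strict monotonicity supplies the gap after the zero exponent that
    \<open>max_mod_pos\<close> asks for.\<close>
  have "\<mu> 1 - \<mu> 0 \<le> \<mu> n - \<mu> 0" if "0 < n" for n
    using that \<mu>(1) by (simp add: strict_mono_less_eq)
  moreover have "0 < \<mu> 1 - \<mu> 0" using \<mu>(1) by (simp add: strict_mono_less)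
  ultimately have "0 < max_mod F \<sigma>" for \<sigma>
    using F.max_mod_pos[of "\<mu> 1 - \<mu> 0"] \<mu>(3) by simp
  then show thesis
    using \<mu>(2) eq F.max_mod_mono f.continuous_on_max_mod by (intro that[of "\<mu> 0" "max_mod F"]) (auto simp: mono_def)
qed

lemma strict_mono_max_mod:
  assumes "vvds f"
  shows "strict_mono (max_mod f)"
proof
  fix x y :: real assume "x < y"
  obtain \<mu> k where k: "0 < \<mu>" "\<And>\<sigma>. max_mod f \<sigma> = exp (\<mu> * \<sigma>) * k \<sigma>" "mono k" "\<And>\<sigma>. 0 < k \<sigma>"
    using vvds_max_mod_factor[OF assms] by metis
  show "max_mod f x < max_mod f y"
    unfolding k(2) using k(1,4) \<open>x < y\<close> monoD[OF k(3), of x y] less_imp_le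
    by (intro mult_less_le_imp_less) auto
qed

lemma range_max_mod:
  assumes "vvds f"
  shows "range (max_mod f) = {0<..}"
proof (intro equalityI subsetI)
  obtain \<mu> k where k: "0 < \<mu>" "\<And>\<sigma>. max_mod f \<sigma> = exp (\<mu> * \<sigma>) * k \<sigma>" "mono k" "\<And>\<sigma>. 0 < k \<sigma>"
    and cont: "continuous_on UNIV (max_mod f)"
    using vvds_max_mod_factor[OF assms] by metis
  show "y \<in> {0<..}" if "y \<in> range (max_mod f)" for y
    using that k(2,4) by auto
  fix y :: real assume "y \<in> {0<..}"
  \<comment> \<open>At this point \<open>exp (\<mu> * x) * k 0\<close> equals \<open>y\<close>.
    Since \<open>k\<close> is monotone, \<open>y\<close> lies between the values of
    \<open>max_mod f\<close> at 0 and at \<open>x\<close>, whatever the sign of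
    \<open>x\<close>.\<close>
  define x where "x = ln (y / k 0) / \<mu>"
  have y: "y = exp (\<mu> * x) * k 0"
    using \<open>y \<in> {0<..}\<close> k(1,4) by (simp add: x_def less_imp_neq[symmetric])
  have "\<exists>z. max_mod f z = y"
  proof (cases "0 \<le> x")
    case True
    have "max_mod f 0 \<le> y" "y \<le> max_mod f x"
      using k(1,4) monoD[OF k(3) True] True by (simp_all add: k(2) y)
    then show ?thesis
      using IVT'[of "max_mod f" 0 y x] True continuous_on_subset[OF cont] by auto
  next
    case False
    then have "max_mod f x \<le> y" "y \<le> max_mod f 0"
      using k(1,4) monoD[OF k(3), of x 0] by (simp_all add: k(2) y mult_nonneg_nonpos)
    then show ?thesis
      using IVT'[of "max_mod f" x y 0] False continuous_on_subset[OF cont] by auto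
  qed
  then show "y \<in> range (max_mod f)" by auto
qed

section \<open>Change of variables at infinity and iterated logarithms\<close>

lemma filtermap_at_top_bij:
  fixes \<phi> :: "real \<Rightarrow> real"
  assumes "strict_mono \<phi>" "surj \<phi>"
  shows "filtermap \<phi> at_top = at_top"
proof (rule filtermap_fun_inverse[where g = "inv \<phi>"])
  show "filterlim \<phi> at_top at_top"
    unfolding filterlim_at_top
  proof
    fix Z
    obtain z where "\<phi> z = Z" using \<open>surj \<phi>\<close> by (metis surjD)
    then show "\<forall>\<^sub>F x in at_top. Z \<le> \<phi> x"
      using eventually_ge_at_top[of z] assms(1) by (auto elim!: eventually_mono simp: strict_mono_less_eq)
  qed
  show "filterlim (inv \<phi>) at_top at_top"
    unfolding filterlim_at_top
  proof
    fix Z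
    have "Z \<le> inv \<phi> x" if "\<phi> Z \<le> x" for x
      using that assms by (metis strict_mono_less_eq surj_f_inv_f)
    with eventually_ge_at_top[of "\<phi> Z"] show "\<forall>\<^sub>F x in at_top. Z \<le> inv \<phi> x"
      by (rule eventually_mono)
  qed
  show "\<forall>\<^sub>F x in at_top. \<phi> (inv \<phi> x) = x"
    using assms(2) by (simp add: surj_f_inv_f)
qed

text \<open>Both maximum moduli have the positive reals as range, so \<open>inv\<close> acts as a
  true inverse at the values of \<open>max_mod f\<close>.\<close>

lemma max_mod_max_mod_inv:
  assumes "vvds f" "vvds g"
  shows "max_mod g (max_mod_inv g (max_mod f x)) = max_mod f x"
proof -
  have "max_mod f x \<in> range (max_mod g)"
    using range_max_mod[OF assms(1)] range_max_mod[OF assms(2)] by blast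
  then show ?thesis unfolding max_mod_inv_def by (rule f_inv_into_f)
qed

lemma strict_mono_max_mod_inv:
  assumes "vvds f" "vvds g"
  shows "strict_mono (\<lambda>x. max_mod_inv g (max_mod f x))"
  unfolding strict_mono_def
  by (metis assms max_mod_max_mod_inv strict_mono_less strict_mono_max_mod)

text \<open>Makes this map a legitimate substitution in upper and lower limits at infinity.
  Surjectivity comes from exchanging \<open>f\<close> and \<open>g\<close>.\<close>

lemma filtermap_max_mod_inv:
  assumes "vvds f" "vvds g"
  shows "filtermap (\<lambda>x. max_mod_inv g (max_mod f x)) at_top = at_top"
proof (intro filtermap_at_top_bij strict_mono_max_mod_inv assms surjI)
  show "max_mod_inv g (max_mod f (max_mod_inv f (max_mod g y))) = y" for y
    using max_mod_max_mod_inv[OF assms(2,1)] strict_mono_max_mod[OF assms(2)]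
    by (simp add: max_mod_inv_def inv_f_f strict_mono_imp_inj_on)
qed

text \<open>Relates the functions in the types to those in the orders. For \<open>k = 0\<close> the
  index \<open>-1\<close> yields \<open>exp\<close>, which \<open>ln\<close> undoes.\<close>

lemma ln_itlog: "0 \<le> k \<Longrightarrow> ln (itlog (k - 1) x) = itlog k x"
proof (cases "k = 0")
  case False
  assume "0 \<le> k"
  with False have "nat k = Suc (nat (k - 1))" "0 \<le> k - 1" by auto
  then show ?thesis by (simp add: itlog_def)
qed (simp add: itlog_def)

lemma filterlim_itlog_at_top: "filterlim (itlog k) at_top at_top"
proof -
  have pow: "filterlim (\<phi> ^^ n) at_top at_top"
    if "filterlim \<phi> at_top at_top" for \<phi> :: "real \<Rightarrow> real" and n
    by (induction n) (auto simp: filterlim_ident id_def comp_def intro: filterlim_compose[OF that])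
  show ?thesis
    unfolding itlog_def[abs_def] using pow[OF ln_at_top] pow[OF exp_at_top]
    by (cases "0 \<le> k") (auto simp: id_def)
qed

section \<open>Powers and quotients of extended reals\<close>

lemma powr_le_imp_epowr_le:
  assumes "0 \<le> x" "x \<le> ereal (K powr s)" "0 < s" "0 < K"
  shows "epowr x (1 / s) \<le> ereal K"
proof -
  obtain y where y: "x = ereal y" "0 \<le> y" "y \<le> K powr s"
    using assms by (cases x) auto
  have "y powr (1 / s) \<le> (K powr s) powr (1 / s)"
    using y assms by (intro powr_mono2) auto
  then show ?thesis using y assms by (simp add: epowr_def powr_powr)
qed

lemma powr_le_imp_le_epowr:
  assumes "ereal (K powr s) \<le> x" "0 < s" "0 < K"
  shows "ereal K \<le> epowr x (1 / s)"
proof (cases x)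
  case (real y)
  have "(K powr s) powr (1 / s) \<le> y powr (1 / s)"
    using real assms by (intro powr_mono2) auto
  then show ?thesis using real assms by (simp add: epowr_def powr_powr)
qed (use assms in \<open>auto simp: epowr_def\<close>)

text \<open>For \<open>y = 0\<close> the bound forces \<open>x = 0\<close>; there and for
  \<open>y = \<infinity>\<close> the quotient evaluates to 0.\<close>

lemma ereal_divide_le_of_le_mult:
  fixes x y :: ereal
  assumes "x \<le> ereal k * y" "0 \<le> x" "0 \<le> y" "0 \<le> k"
  shows "x / y \<le> ereal k"
proof (cases "y = 0 \<or> y = \<infinity>")
  case False
  then obtain r where "y = ereal r" "0 < r" using assms by (cases y) auto
  then show ?thesis using assms by (cases x) (auto simp: field_simps)
next
  case True
  moreover have "x = 0" if "y = 0" using assms that by simp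
  ultimately show ?thesis using assms by (auto simp: divide_ereal_def)
qed

text \<open>A lower bound must rule out the quotients that evaluate to 0 by convention:
  \<open>y = 0\<close> then makes the quotient infinite, and \<open>y = \<infinity>\<close> would
  force \<open>x = \<infinity>\<close>.\<close>

lemma le_ereal_divide_of_mult_le:
  fixes x y :: ereal
  assumes "ereal k * y \<le> x" "0 \<le> y" "0 < k" "0 \<le> x" "meaningful_quotient x y"
  shows "ereal k \<le> x / y"
proof -
  consider "y = 0" | "y = \<infinity>" | r where "y = ereal r" "0 < r"
    using assms by (cases y) force+
  then show ?thesis
  proof cases
    case 1
    then have "0 < x" using assms by (auto simp: meaningful_quotient_def order_less_le)
    then show ?thesis using 1 by (cases x) (auto simp: divide_ereal_def)
  next
    case 2
    then show ?thesis using assms by (auto simp: meaningful_quotient_def)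
  next
    case 3
    then show ?thesis using assms by (cases x) (auto simp: field_simps)
  qed
qed

text \<open>Supplies a real threshold \<open>z\<close> below a possibly infinite lower limit
  \<open>y\<close>.\<close>

lemma ereal_less_mult_dense:
  fixes x y :: ereal
  assumes "x < ereal k * y" "0 < k" "0 \<le> x"
  obtains z where "x < ereal (k * z)" "ereal z < y"
proof -
  obtain r where r: "x = ereal r" using assms by (cases x) auto
  have "ereal (r / k) < y" using assms r by (cases y) (auto simp: field_simps)
  then obtain z where "ereal (r / k) < ereal z" "ereal z < y" using ereal_dense2 by blast
  then show thesis using r \<open>0 < k\<close> that by (simp add: field_simps)
qed

section \<open>Growth estimates for three functions tending to infinity\<close>

text \<open>
  The parameters \<open>lf\<close>, \<open>lg\<close>, \<open>rg\<close>, \<open>lgf\<close> stand for \<open>\<lambda>_h(f)\<close>, \<open>\<lambda>_h(g)\<close>, \<open>\<rho>_h(g)\<close>, \<open>\<lambda>_g(f)\<close>.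
\<close>

locale relative_growth =
  fixes Fl :: "'a filter" and a c d :: "'a \<Rightarrow> real" and lf lg rg lgf :: real
  assumes nontriv: "Fl \<noteq> bot"
    and a_top: "filterlim a at_top Fl"
    and c_top: "filterlim c at_top Fl"
    and d_top: "filterlim d at_top Fl"
    and lf: "Liminf Fl (\<lambda>x. ereal (ln (a x) / ln (d x))) = ereal lf"
    and lg: "Liminf Fl (\<lambda>x. ereal (ln (a x) / ln (c x))) = ereal lg"
    and rg: "Limsup Fl (\<lambda>x. ereal (ln (a x) / ln (c x))) = ereal rg"
    and lgf: "Liminf Fl (\<lambda>x. ereal (ln (c x) / ln (d x))) = ereal lgf"
    and lg_pos: "0 < lg" and lgf_pos: "0 < lgf"
begin

lemma eventually_gt_1: "\<forall>\<^sub>F x in Fl. 1 < a x \<and> 1 < c x \<and> 1 < d x"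
  using a_top c_top d_top unfolding filterlim_at_top_dense by (simp add: eventually_conj_iff)

lemma rg_pos: "0 < rg"
  using Liminf_le_Limsup[OF nontriv, of "\<lambda>x. ereal (ln (a x) / ln (c x))"] lg_pos
  unfolding lg rg by simp

text \<open>The quotient \<open>ln a / ln d\<close> is the product of \<open>ln c / ln d\<close> and
  \<open>ln a / ln c\<close>, and lower limits of positive factors are supermultiplicative.\<close>

lemma lower_orders_mult_le: "lgf * lg \<le> lf"
proof -
  have *: "t * s \<le> lf" if "0 < s" "s < lg" "0 < t" "t < lgf" for s t
  proof -
    have "\<forall>\<^sub>F x in Fl. s < ln (a x) / ln (c x)"
      using less_LiminfD[of "ereal s" Fl "\<lambda>x. ereal (ln (a x) / ln (c x))"] that by (simp add: lg)
    moreover have "\<forall>\<^sub>F x in Fl. t < ln (c x) / ln (d x)"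
      using less_LiminfD[of "ereal t" Fl "\<lambda>x. ereal (ln (c x) / ln (d x))"] that by (simp add: lgf)
    ultimately have "\<forall>\<^sub>F x in Fl. ereal (t * s) \<le> ereal (ln (a x) / ln (d x))"
      using eventually_gt_1
    proof eventually_elim
      case (elim x)
      then have "t * s \<le> (ln (c x) / ln (d x)) * (ln (a x) / ln (c x))"
        using that by (intro mult_mono) auto
      then show ?case using elim by simp
    qed
    then have "ereal (t * s) \<le> ereal lf" unfolding lf[symmetric] by (rule Liminf_bounded)
    then show ?thesis by simp
  qed
  \<comment> \<open>The limits \<open>s\<close> to \<open>lg\<close> and \<open>t\<close> to
    \<open>lgf\<close> are taken one after the other.\<close>
  have "t \<le> lf / lg" if "0 < t" "t < lgf" for t
  proof -
    have "s \<le> lf / t" if "0 < s" "s < lg" for s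
      using *[OF that \<open>0 < t\<close> \<open>t < lgf\<close>] \<open>0 < t\<close> by (simp add: field_simps)
    then have "lg \<le> lf / t" using dense_le_bounded[OF lg_pos] by blast
    then show ?thesis using that lg_pos by (simp add: field_simps)
  qed
  then have "lgf \<le> lf / lg" using dense_le_bounded[OF lgf_pos] by blast
  then show ?thesis using lg_pos by (simp add: field_simps)
qed

text \<open>In the same factorization, if \<open>lf\<close> exceeded \<open>T * R\<close> while
  \<open>ln a / ln c\<close> is eventually below \<open>R\<close>, then \<open>ln c / ln d\<close>
  would eventually be at least \<open>T\<close>, against \<open>lgf < T\<close>.\<close>

lemma lower_order_le_mult: "lf \<le> lgf * rg"
proof -
  have *: "lf \<le> T * R" if "rg < R" "lgf < T" for R T
  proof (rule ccontr)
    assume "\<not> lf \<le> T * R"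
    then have "\<forall>\<^sub>F x in Fl. T * R < ln (a x) / ln (d x)"
      using less_LiminfD[of "ereal (T * R)" Fl "\<lambda>x. ereal (ln (a x) / ln (d x))"] by (simp add: lf)
    moreover have "\<forall>\<^sub>F x in Fl. ln (a x) / ln (c x) < R"
      using Limsup_lessD[of Fl "\<lambda>x. ereal (ln (a x) / ln (c x))" "ereal R"] that by (simp add: rg)
    ultimately have "\<forall>\<^sub>F x in Fl. ereal T \<le> ereal (ln (c x) / ln (d x))"
      using eventually_gt_1
    proof eventually_elim
      case (elim x)
      show ?case
      proof (rule ccontr)
        assume "\<not> ereal T \<le> ereal (ln (c x) / ln (d x))"
        then have "(ln (c x) / ln (d x)) * (ln (a x) / ln (c x)) \<le> T * R"
          using elim that lgf_pos by (intro mult_mono) auto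
        then show False using elim by simp
      qed
    qed
    then have "ereal T \<le> ereal lgf" unfolding lgf[symmetric] by (rule Liminf_bounded)
    with that show False by simp
  qed
  have "lf / rg \<le> T" if "lgf < T" for T
  proof -
    have "lf / T \<le> R" if "rg < R" for R
      using *[OF that \<open>lgf < T\<close>] \<open>lgf < T\<close> lgf_pos by (simp add: field_simps)
    then have "lf / T \<le> rg" using dense_ge by blast
    then show ?thesis using that rg_pos lgf_pos by (simp add: field_simps)
  qed
  then have "lf / rg \<le> lgf" using dense_ge by blast
  then show ?thesis using rg_pos by (simp add: field_simps)
qed

lemma Liminf_quotient_nonneg:
  assumes "u = a \<or> u = c" and "v = c \<or> v = d"
  shows "0 \<le> Liminf Fl (\<lambda>x. ereal (u x / v x powr r))"
  using eventually_gt_1 assms by (intro Liminf_bounded, elim eventually_mono) auto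

lemma Limsup_quotient_nonneg:
  assumes "u = a \<or> u = c" and "v = c \<or> v = d"
  shows "0 \<le> Limsup Fl (\<lambda>x. ereal (u x / v x powr r))"
  using Liminf_quotient_nonneg[OF assms] Liminf_le_Limsup[OF nontriv] order_trans by blast

text \<open>Raising \<open>c \<le> K * d powr lgf\<close> to the power \<open>lg\<close> produces
  the exponent \<open>lgf * lg\<close> on \<open>d\<close>; as \<open>d > 1\<close>, it may be
  enlarged to \<open>lf\<close>.\<close>

lemma eventually_quotient_le:
  assumes "Limsup Fl (\<lambda>x. ereal (c x / d x powr lgf)) < ereal K"
  shows "\<forall>\<^sub>F x in Fl. ereal (a x / d x powr lf) \<le> ereal (K powr lg) * ereal (a x / c x powr lg)"
  using Limsup_lessD[OF assms] eventually_gt_1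
proof eventually_elim
  case (elim x)
  then have "c x \<le> K * d x powr lgf" by (simp add: field_simps)
  then have "c x powr lg \<le> (K * d x powr lgf) powr lg"
    using elim lg_pos by (intro powr_mono2) auto
  also have "\<dots> = K powr lg * d x powr (lgf * lg)"
    by (simp add: powr_mult powr_powr)
  also have "\<dots> \<le> K powr lg * d x powr lf"
    using elim lower_orders_mult_le by (intro mult_left_mono powr_mono) auto
  finally have "c x powr lg * a x \<le> K powr lg * d x powr lf * a x"
    using elim by (intro mult_right_mono) auto
  then show ?case using elim by (simp add: field_simps)
qed

text \<open>A lower bound for an upper limit holds only frequently. After raising to the power
  \<open>rg\<close>, the exponent \<open>lgf * rg\<close> on \<open>d\<close> may be decreased to
  \<open>lf\<close>.\<close>

lemma frequently_quotient_ge: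
  assumes "ereal K < Limsup Fl (\<lambda>x. ereal (c x / d x powr lgf))" "0 < K"
  shows "\<exists>\<^sub>F x in Fl. K powr rg * (a x / c x powr rg) \<le> a x / d x powr lf"
proof -
  have "\<exists>\<^sub>F x in Fl. K < c x / d x powr lgf"
  proof (rule ccontr)
    assume "\<not> ?thesis"
    then have "Limsup Fl (\<lambda>x. ereal (c x / d x powr lgf)) \<le> ereal K"
      by (intro Limsup_bounded) (simp add: not_frequently not_less)
    with assms show False by simp
  qed
  from frequently_eventually_frequently[OF this eventually_gt_1]
  show ?thesis
  proof (rule frequently_elim1)
    fix x assume x: "K < c x / d x powr lgf \<and> 1 < a x \<and> 1 < c x \<and> 1 < d x"
    then have "K * d x powr lgf \<le> c x" by (auto simp: pos_less_divide_eq)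
    then have "(K * d x powr lgf) powr rg \<le> c x powr rg"
      using x rg_pos \<open>0 < K\<close> by (intro powr_mono2) auto
    moreover have "K powr rg * d x powr lf \<le> K powr rg * d x powr (lgf * rg)"
      using x lower_order_le_mult by (intro mult_left_mono powr_mono) auto
    ultimately have "K powr rg * d x powr lf \<le> c x powr rg"
      by (simp add: powr_mult powr_powr)
    then have "K powr rg * d x powr lf * a x \<le> c x powr rg * a x"
      using x by (intro mult_right_mono) auto
    then show "K powr rg * (a x / c x powr rg) \<le> a x / d x powr lf"
      using x by (simp add: field_simps)
  qed
qed

text \<open>Common argument for both terms of the maximum, with \<open>x\<close> and
  \<open>y\<close> a pair of upper limits or a pair of lower limits. A real \<open>K\<close>
  strictly between the two sides would contradict \<open>bound\<close> at \<open>K\<close>.\<close>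

lemma epowr_quotient_le:
  assumes bound: "\<And>K. 0 < K \<Longrightarrow> Limsup Fl (\<lambda>x. ereal (c x / d x powr lgf)) < ereal K \<Longrightarrow> x \<le> ereal (K powr lg) * y"
    and "0 \<le> x" "0 \<le> y"
  shows "epowr (x / y) (1 / lg) \<le> Limsup Fl (\<lambda>x. ereal (c x / d x powr lgf))" (is "_ \<le> ?T")
proof (rule ccontr)
  assume "\<not> ?thesis"
  then have "?T < epowr (x / y) (1 / lg)" by (simp only: not_le)
  then obtain K where K: "?T < ereal K" "ereal K < epowr (x / y) (1 / lg)"
    using ereal_dense2 by blast
  have "0 \<le> ?T" by (intro Limsup_quotient_nonneg) auto
  from order_le_less_trans[OF this K(1)] have "0 < K" by simp
  have "0 \<le> x / y"
    using assms(2,3) by (simp add: divide_ereal_def ereal_inverse_nonneg_iff)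
  then have "epowr (x / y) (1 / lg) \<le> ereal K"
    using bound[OF \<open>0 < K\<close> K(1)] assms(2,3) lg_pos \<open>0 < K\<close>
    by (intro powr_le_imp_epowr_le ereal_divide_le_of_le_mult) auto
  with K(2) show False by simp
qed

lemma weak_types_le:
  "max (epowr (Limsup Fl (\<lambda>x. ereal (a x / d x powr lf)) / Limsup Fl (\<lambda>x. ereal (a x / c x powr lg))) (1 / lg))
       (epowr (Liminf Fl (\<lambda>x. ereal (a x / d x powr lf)) / Liminf Fl (\<lambda>x. ereal (a x / c x powr lg))) (1 / lg))
    \<le> Limsup Fl (\<lambda>x. ereal (c x / d x powr lgf))"
proof (intro max.boundedI epowr_quotient_le)
  fix K :: real assume K: "0 < K" "Limsup Fl (\<lambda>x. ereal (c x / d x powr lgf)) < ereal K"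
  show "Limsup Fl (\<lambda>x. ereal (a x / d x powr lf)) \<le> ereal (K powr lg) * Limsup Fl (\<lambda>x. ereal (a x / c x powr lg))"
    using Limsup_mono[OF eventually_quotient_le[OF K(2)]]
    unfolding Limsup_ereal_mult_left[OF nontriv powr_ge_zero] .
  show "Liminf Fl (\<lambda>x. ereal (a x / d x powr lf)) \<le> ereal (K powr lg) * Liminf Fl (\<lambda>x. ereal (a x / c x powr lg))"
    using Liminf_mono[OF eventually_quotient_le[OF K(2)]]
    unfolding Liminf_ereal_mult_left[OF nontriv powr_ge_zero] .
qed (auto intro!: Limsup_quotient_nonneg Liminf_quotient_nonneg)

lemma weak_type_sup_le:
  assumes mq: "meaningful_quotient (Limsup Fl (\<lambda>x. ereal (a x / d x powr lf))) (Liminf Fl (\<lambda>x. ereal (a x / c x powr rg)))"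
      (is "meaningful_quotient ?X ?Y")
  shows "Limsup Fl (\<lambda>x. ereal (c x / d x powr lgf)) \<le> epowr (?X / ?Y) (1 / rg)" (is "?T \<le> _")
proof (rule ccontr)
  have X: "0 \<le> ?X" and Y: "0 \<le> ?Y"
    by (auto intro!: Limsup_quotient_nonneg Liminf_quotient_nonneg)
  assume "\<not> ?thesis"
  then have "epowr (?X / ?Y) (1 / rg) < ?T" by (simp only: not_le)
  then obtain K where K: "epowr (?X / ?Y) (1 / rg) < ereal K" "ereal K < ?T"
    using ereal_dense2 by blast
  have "0 \<le> epowr (?X / ?Y) (1 / rg)" by (simp add: epowr_def)
  from order_le_less_trans[OF this K(1)] have "0 < K" by simp
  \<comment> \<open>A frequent inequality suffices because \<open>?Y\<close> is a lower and
    \<open>?X\<close> an upper limit: otherwise a real \<open>y\<close> would eventually separate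
    the two quotients in the opposite direction.\<close>
  have "ereal (K powr rg) * ?Y \<le> ?X"
  proof (rule ccontr)
    assume "\<not> ?thesis"
    then have "?X < ereal (K powr rg) * ?Y" by (simp only: not_le)
    then obtain y where y: "?X < ereal (K powr rg * y)" "ereal y < ?Y"
      using ereal_less_mult_dense[of ?X "K powr rg" ?Y] \<open>0 < K\<close> X by auto
    have "\<forall>\<^sub>F x in Fl. a x / d x powr lf < K powr rg * y"
      using Limsup_lessD[OF y(1)] by simp
    moreover have "\<forall>\<^sub>F x in Fl. y < a x / c x powr rg"
      using less_LiminfD[OF y(2)] by simp
    ultimately have "\<forall>\<^sub>F x in Fl. \<not> K powr rg * (a x / c x powr rg) \<le> a x / d x powr lf"
    proof eventually_elim
      case (elim x)
      then have "K powr rg * y < K powr rg * (a x / c x powr rg)"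
        using \<open>0 < K\<close> by (intro mult_strict_left_mono) auto
      with elim show ?case by linarith
    qed
    with frequently_quotient_ge[OF K(2) \<open>0 < K\<close>] show False by (simp add: frequently_def)
  qed
  then have "ereal K \<le> epowr (?X / ?Y) (1 / rg)"
    using \<open>0 < K\<close> rg_pos X Y mq by (intro powr_le_imp_le_epowr le_ereal_divide_of_mult_le) auto
  with K(1) show False by simp
qed

end

section \<open>Translation of relative orders and types into the three-function setting\<close>

theorem theorem5:
  fixes p q m :: int
    and f :: "complex \<Rightarrow> 'f::complex_banach"
    and g :: "complex \<Rightarrow> 'g::complex_banach"
    and h :: "complex \<Rightarrow> 'h::complex_banach"
  assumes "p \<ge> 0" and "q \<ge> 0" and "m \<ge> 0"
    and "vvds f" and "vvds g" and "vvds h"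
    and "rel_index_pair h f m q"
    and "rel_index_pair h g m p"
    and "0 < rel_lower_order h f m q" and "rel_lower_order h f m q < \<infinity>"
    and "0 < rel_lower_order h g m p" and "rel_lower_order h g m p < \<infinity>"
    and "0 < rel_lower_order g f p q" and "rel_lower_order g f p q < \<infinity>"
    and "meaningful_quotient (rel_weak_type_sup h f m q) (rel_weak_type_sup h g m p)"
    and "meaningful_quotient (rel_weak_type h f m q) (rel_weak_type h g m p)"
    and "meaningful_quotient (rel_weak_type_sup h f m q) (rel_lower_type h g m p)"
  shows "max (epowr (rel_weak_type_sup h f m q / rel_weak_type_sup h g m p)
                (1 / real_of_ereal (rel_lower_order h g m p)))
             (epowr (rel_weak_type h f m q / rel_weak_type h g m p)
                (1 / real_of_ereal (rel_lower_order h g m p)))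
           \<le> rel_weak_type_sup g f p q \<and>
         rel_weak_type_sup g f p q
           \<le> epowr (rel_weak_type_sup h f m q / rel_lower_type h g m p)
                (1 / real_of_ereal (rel_order h g m p))"
proof -
  define \<phi> where "\<phi> = (\<lambda>\<sigma>. max_mod_inv g (max_mod f \<sigma>))"
  define H where "H = (\<lambda>\<sigma>. max_mod_inv h (max_mod f \<sigma>))"
  define a where "a = (\<lambda>\<sigma>. itlog (m - 1) (H \<sigma>))"
  define c where "c = (\<lambda>\<sigma>. itlog (p - 1) (\<phi> \<sigma>))"
  define d where "d = itlog (q - 1)"
  have \<phi>: "filtermap \<phi> at_top = at_top" "inj \<phi>"
    unfolding \<phi>_def using assms(4,5)
    by (simp_all add: filtermap_max_mod_inv strict_mono_max_mod_inv strict_mono_imp_inj_on)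
  have H: "filtermap H at_top = at_top"
    unfolding H_def using assms(4,6) by (rule filtermap_max_mod_inv)
  have Liminf_subst: "Liminf at_top X = Liminf at_top (\<lambda>\<sigma>. X (\<phi> \<sigma>))" for X :: "real \<Rightarrow> ereal"
    using Liminf_filtermap_eq[OF \<phi>(2), of at_top X] by (simp only: \<phi>(1))
  have Limsup_subst: "Limsup at_top X = Limsup at_top (\<lambda>\<sigma>. X (\<phi> \<sigma>))" for X :: "real \<Rightarrow> ereal"
    using Limsup_filtermap_eq[OF \<phi>(2), of at_top X] by (simp only: \<phi>(1))
  \<comment> \<open>Since the maximum modulus of \<open>g\<close> at \<open>\<phi> \<sigma>\<close>
    is that of \<open>f\<close> at \<open>\<sigma>\<close>, substituting \<open>\<phi>\<close> turns
    every quantity of \<open>(h, g)\<close> into one in \<open>a\<close> and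
    \<open>c\<close>.\<close>
  have g_\<phi>: "max_mod_inv h (max_mod g (\<phi> \<sigma>)) = H \<sigma>" for \<sigma>
    unfolding \<phi>_def H_def using assms(4,5) by (simp add: max_mod_max_mod_inv)
  have ln_eqs: "ln (a \<sigma>) = itlog m (H \<sigma>)" "ln (c \<sigma>) = itlog p (\<phi> \<sigma>)" "ln (d \<sigma>) = itlog q \<sigma>" for \<sigma>
    using assms(1-3) by (simp_all add: a_def c_def d_def ln_itlog)

  have lf: "rel_lower_order h f m q = Liminf at_top (\<lambda>\<sigma>. ereal (ln (a \<sigma>) / ln (d \<sigma>)))"
    by (simp add: rel_lower_order_def ln_eqs H_def)
  have lg: "rel_lower_order h g m p = Liminf at_top (\<lambda>\<sigma>. ereal (ln (a \<sigma>) / ln (c \<sigma>)))"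
    unfolding rel_lower_order_def by (subst Liminf_subst) (simp add: ln_eqs g_\<phi>)
  have rg: "rel_order h g m p = Limsup at_top (\<lambda>\<sigma>. ereal (ln (a \<sigma>) / ln (c \<sigma>)))"
    unfolding rel_order_def by (subst Limsup_subst) (simp add: ln_eqs g_\<phi>)
  have lgf: "rel_lower_order g f p q = Liminf at_top (\<lambda>\<sigma>. ereal (ln (c \<sigma>) / ln (d \<sigma>)))"
    by (simp add: rel_lower_order_def ln_eqs \<phi>_def)
  \<comment> \<open>The lower threshold in \<open>rel_index_pair\<close> is 0 or 1, so the order is
    positive in either case.\<close>
  have "0 < rel_order h g m p" "rel_order h g m p < \<infinity>"
    using \<open>rel_index_pair h g m p\<close> unfolding rel_index_pair_def
    by (auto split: if_splits intro: order_less_trans[OF zero_less_one])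
  then obtain rg' where rg': "rel_order h g m p = ereal rg'"
    by (cases "rel_order h g m p") auto
  obtain lf' where lf': "rel_lower_order h f m q = ereal lf'"
    using assms(9,10) by (cases "rel_lower_order h f m q") auto
  obtain lg' where lg': "rel_lower_order h g m p = ereal lg'" "0 < lg'"
    using assms(11,12) by (cases "rel_lower_order h g m p") auto
  obtain lgf' where lgf': "rel_lower_order g f p q = ereal lgf'" "0 < lgf'"
    using assms(13,14) by (cases "rel_lower_order g f p q") auto

  interpret relative_growth at_top a c d lf' lg' rg' lgf'
  proof
    have "filterlim H at_top at_top" "filterlim \<phi> at_top at_top"
      by (simp_all add: filterlim_def H \<phi>(1))
    then show "filterlim a at_top at_top" "filterlim c at_top at_top" "filterlim d at_top at_top"
      unfolding a_def c_def d_def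
      by (auto intro: filterlim_itlog_at_top filterlim_compose[OF filterlim_itlog_at_top])
  qed (use lf lg rg lgf lf' lg' rg' lgf' in simp_all)

  have types:
    "rel_weak_type_sup h f m q = Limsup at_top (\<lambda>\<sigma>. ereal (a \<sigma> / d \<sigma> powr lf'))"
    "rel_weak_type h f m q = Liminf at_top (\<lambda>\<sigma>. ereal (a \<sigma> / d \<sigma> powr lf'))"
    "rel_weak_type_sup g f p q = Limsup at_top (\<lambda>\<sigma>. ereal (c \<sigma> / d \<sigma> powr lgf'))"
    by (simp_all add: rel_weak_type_sup_def rel_weak_type_def lf' lgf' a_def c_def d_def H_def \<phi>_def)
  have sup_type_g: "rel_weak_type_sup h g m p = Limsup at_top (\<lambda>\<sigma>. ereal (a \<sigma> / c \<sigma> powr lg'))"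
    unfolding rel_weak_type_sup_def by (subst Limsup_subst) (simp add: lg' a_def c_def g_\<phi>)
  have weak_type_g: "rel_weak_type h g m p = Liminf at_top (\<lambda>\<sigma>. ereal (a \<sigma> / c \<sigma> powr lg'))"
    unfolding rel_weak_type_def by (subst Liminf_subst) (simp add: lg' a_def c_def g_\<phi>)
  have lower_type_g: "rel_lower_type h g m p = Liminf at_top (\<lambda>\<sigma>. ereal (a \<sigma> / c \<sigma> powr rg'))"
    unfolding rel_lower_type_def by (subst Liminf_subst) (simp add: rg' a_def c_def g_\<phi>)
  show ?thesis
    using weak_types_le weak_type_sup_le assms(17)
    by (simp only: types sup_type_g weak_type_g lower_type_g lg' rg' real_of_ereal.simps)
qed

end
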